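(* Let $(X,d)$ be a nonempty complete metric space and let $T : X \to X$ be a significant pointwise contractive (SPC) mapping, i.e. there exists $c \in [0,1)$ such that for all $x,y \in X$, $d(x,y) \leq d(x,Tx)$ implies $d(Tx,Ty) \leq c\, d(x,y)$. Then $T$ has a fixed point, i.e. there exists $x^* \in X$ with $Tx^* = x^*$.
   Context: Let $(X,d)$ be a metric space. A mapping $T : X \to X$ is called significant pointwise contractive (SPC) if there exists $c \in [0,1)$ such that, for all $x,y \in X$, $d(x,y) \leq d(x,Tx)$ implies $d(Tx,Ty) \leq c\, d(x,y)$. *)

theory Defs
  imports "HOL-Analysis.Analysis"
begin

definition (in Metric_space) SPC :: "('a \<Rightarrow> 'a) \<Rightarrow> bool" where
  "SPC T \<longleftrightarrow> T \<in> M \<rightarrow> M \<and>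
    (\<exists>c::real. 0 \<le> c \<and> c < 1 \<and>
      (\<forall>x\<in>M. \<forall>y\<in>M. d x y \<le> d x (T x) \<longrightarrow> d (T x) (T y) \<le> c * d x y))"

end

(* The SPC condition at the pair (x, Tx) makes Picard iterates Cauchy. If their limit z were not
   fixed, the iterates would eventually lie within d(z, Tz) of z, so the SPC condition at (z, T^n w)
   applies and forces T^(n+1) w to converge to Tz as well, contradicting uniqueness of limits. *)
theory Submission
  imports Defs
begin

context Metric_space
begin

text \<open>The triangle inequality gives a finite geometric sum, written here in closed form. The
  factor \<open>1 - c ^ k\<close> is kept because the induction on \<open>k\<close> would not close
  with the cruder bound \<open>B * c ^ m / (1 - c)\<close>.\<close>

lemma mdist_geometric_bound:
  assumes "range s \<subseteq> M" "0 \<le> c" "c < 1"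
    and "\<And>n. d (s n) (s (Suc n)) \<le> B * c ^ n"
  shows "d (s m) (s (m + k)) \<le> B * c ^ m * (1 - c ^ k) / (1 - c)"
proof (induction k)
  case 0
  then show ?case
    using mdist_zero[of "s m"] assms(1) by (simp add: range_subsetD)
next
  case (Suc k)
  have "d (s m) (s (m + Suc k)) \<le> d (s m) (s (m + k)) + d (s (m + k)) (s (Suc (m + k)))"
    using assms(1) triangle by (simp add: range_subsetD)
  also have "\<dots> \<le> B * c ^ m * (1 - c ^ k) / (1 - c) + B * c ^ (m + k)"
    using Suc assms(4) by (meson add_mono)
  also have "\<dots> = B * c ^ m * (1 - c ^ Suc k) / (1 - c)"
    using assms(3) by (simp add: field_simps power_add)
  finally show ?case .
qed

text \<open>The geometric bound is dominated by \<open>B * c ^ m / (1 - c)\<close>, which does not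
  depend on \<open>k\<close> and tends to 0 as \<open>m\<close> grows.\<close>

lemma MCauchy_geometric:
  assumes "range s \<subseteq> M" "0 \<le> c" "c < 1"
    and "\<And>n. d (s n) (s (Suc n)) \<le> B * c ^ n"
  shows "MCauchy s"
  unfolding MCauchy_def
proof (intro conjI allI impI)
  fix \<epsilon> :: real
  assume "\<epsilon> > 0"
  \<comment> \<open>The case \<open>n = 0\<close> of the step bound; the sign is what allows the
    factor \<open>1 - c ^ (n - m)\<close> to be dropped below.\<close>
  have "0 \<le> B"
    using assms(4)[of 0] nonneg[of "s 0" "s (Suc 0)"] by (simp del: nonneg)
  have "(\<lambda>n. B * c ^ n / (1 - c)) \<longlonglongrightarrow> B * 0 / (1 - c)"
    using assms(2,3) by (intro tendsto_intros LIMSEQ_realpow_zero) auto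
  then have "\<forall>\<^sub>F n in sequentially. B * c ^ n / (1 - c) < \<epsilon>"
    using \<open>\<epsilon> > 0\<close> by (auto dest: order_tendstoD)
  then obtain N where N: "\<And>n. n \<ge> N \<Longrightarrow> B * c ^ n / (1 - c) < \<epsilon>"
    by (auto simp: eventually_sequentially)
  have *: "d (s m) (s n) < \<epsilon>" if "N \<le> m" "m \<le> n" for m n
  proof -
    have "d (s m) (s n) \<le> B * c ^ m * (1 - c ^ (n - m)) / (1 - c)"
      using mdist_geometric_bound[OF assms, of m "n - m"] that by simp
    also have "\<dots> \<le> B * c ^ m / (1 - c)"
      using \<open>0 \<le> B\<close> assms(2,3) by (intro divide_right_mono mult_left_le) auto
    also have "\<dots> < \<epsilon>"
      using N that by simp
    finally show ?thesis .
  qed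
  have "d (s m) (s n) < \<epsilon>" if "N \<le> m" "N \<le> n" for m n
    using *[of m n] *[of n m] that commute[of "s m" "s n"] by (cases "m \<le> n") auto
  then show "\<exists>N. \<forall>n n'. N \<le> n \<longrightarrow> N \<le> n' \<longrightarrow> d (s n) (s n') < \<epsilon>"
    by blast
qed (use assms(1) in auto)

lemma SPC_fixpoint:
  assumes "M \<noteq> {}" "mcomplete" "SPC T"
  shows "\<exists>x\<in>M. T x = x"
proof -
  obtain c where T: "T \<in> M \<rightarrow> M" and c: "0 \<le> c" "c < 1"
    and contr: "\<And>x y. \<lbrakk>x \<in> M; y \<in> M; d x y \<le> d x (T x)\<rbrakk> \<Longrightarrow> d (T x) (T y) \<le> c * d x y"
    using assms(3) unfolding SPC_def by blast
  obtain w where "w \<in> M"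
    using assms(1) by blast
  define s where "s n = (T ^^ n) w" for n
  have s_Suc: "s (Suc n) = T (s n)" for n
    by (simp add: s_def)
  have s_M: "s n \<in> M" for n
    by (induction n) (use T \<open>w \<in> M\<close> in \<open>auto simp: s_def\<close>)
  have "d (s n) (s (Suc n)) \<le> d w (T w) * c ^ n" for n
  proof (induction n)
    case (Suc n)
    \<comment> \<open>Since \<open>T (s n) = s (Suc n)\<close>, the premise of \<open>contr\<close>
      at this pair is an equality.\<close>
    have "d (s (Suc n)) (s (Suc (Suc n))) \<le> c * d (s n) (s (Suc n))"
      using contr[of "s n" "s (Suc n)"] s_M by (simp add: s_Suc[symmetric])
    also have "\<dots> \<le> c * (d w (T w) * c ^ n)"
      using Suc c by (intro mult_left_mono)
    finally show ?case
      by (simp add: algebra_simps)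
  qed (simp add: s_def)
  then have "MCauchy s"
    using s_M c by (intro MCauchy_geometric[of s c "d w (T w)"]) auto
  then obtain z where lim: "limitin mtopology s z sequentially"
    using assms(2) unfolding mcomplete_def by blast
  then have "z \<in> M"
    by (simp add: limitin_mspace)
  then have "T z \<in> M"
    using T by auto
  have d0: "(\<lambda>n. d (s n) z) \<longlonglongrightarrow> 0"
    using lim limitin_metric_dist_null by blast
  have "T z = z"
  proof (rule ccontr)
    assume "T z \<noteq> z"
    then have "0 < d z (T z)"
      using \<open>z \<in> M\<close> \<open>T z \<in> M\<close> by auto
    \<comment> \<open>This is the premise of \<open>contr\<close> with \<open>z\<close> as first
      argument: the threshold is then a fixed positive number, whereas
      \<open>d (s n) (T (s n))\<close> would shrink to 0 along with the iterates.\<close>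
    then have "\<forall>\<^sub>F n in sequentially. d (s n) z < d z (T z)"
      using d0 by (auto dest: order_tendstoD)
    then have "\<forall>\<^sub>F n in sequentially. d (s (Suc n)) (T z) \<le> c * d (s n) z"
    proof eventually_elim
      case (elim n)
      then show ?case
        using contr[OF \<open>z \<in> M\<close> s_M[of n]]
        by (simp add: s_Suc commute[of "s n" z] commute[of "T (s n)" "T z"])
    qed
    moreover have "(\<lambda>n. c * d (s n) z) \<longlonglongrightarrow> 0"
      using tendsto_mult_left[OF d0, of c] by simp
    \<comment> \<open>Squeezed between the constant 0 and \<open>c * d (s n) z\<close>; the upper
      bound holds only eventually, the lower one always.\<close>
    ultimately have "(\<lambda>n. d (s (Suc n)) (T z)) \<longlonglongrightarrow> 0"
      by (rule tendsto_sandwich[OF always_eventually _ tendsto_const, rotated]) simp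
    then have "limitin mtopology (\<lambda>n. s (Suc n)) (T z) sequentially"
      using \<open>T z \<in> M\<close> s_M by (simp add: limitin_metric_dist_null)
    \<comment> \<open>The shift puts both limits on the same sequence, so that uniqueness
      applies.\<close>
    moreover have "limitin mtopology (\<lambda>n. s (Suc n)) z sequentially"
      using limitin_sequentially_offset[OF lim, of 1] by simp
    ultimately show False
      using \<open>T z \<noteq> z\<close> by (auto dest: limitin_metric_unique)
  qed
  with \<open>z \<in> M\<close> show ?thesis
    by blast
qed

end

theorem theorem2p2:
  fixes X :: "'a set" and d :: "'a \<Rightarrow> 'a \<Rightarrow> real" and T :: "'a \<Rightarrow> 'a"
  assumes "Metric_space X d"
    and "X \<noteq> {}"
    and "Metric_space.mcomplete X d"
    and "Metric_space.SPC X d T"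
  shows "\<exists>x\<in>X. T x = x"
  using Metric_space.SPC_fixpoint[OF assms] .

end
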